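(* For every $n\ge2$ and every $S=(s_1,\ldots,s_n)\in\mathcal{G}_n$, $$s_n-A(S)-1\in K_S\quad\text{and}\quad s_n+A(S)+1\in K_S.$$
   Context: For a finite integer sequence $S=(s_1,\ldots,s_n)$, its difference triangle is defined by $s_a^0:=s_a$ and $s_a^b:=|s_{a+1}^{b-1}-s_a^{b-1}|$ for $b\ge 1$, $1\le a\le n-b$ (superscripts are row indices, not powers). $S$ is Gilbreath if $s_1^b=1$ for every $1\le b\le n-1$. For $n\ge 2$, $\mathcal{G}_n$ is the set of strictly increasing Gilbreath integer sequences $(s_1,\ldots,s_n)$ of length $n$ with $(s_1,s_2)=(2,3)$. The valid-extension set of $S$ is $K_S:=\{k\in\mathbb{Z}:(s_1,\ldots,s_n,k)\text{ is Gilbreath}\}$. The right anti-diagonal of $S$ is $(e_1,\ldots,e_{n-1})$ with $e_i:=s_{n-i}^i$, and $A(S):=\sum_{i=1}^{n-1}e_i$. *)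

theory Defs
  imports Main
begin

text \<open>
  The sequence \<open>(s\<^sub>1, \<dots>, s\<^sub>n)\<close> is the list \<open>[s\<^sub>1, \<dots>, s\<^sub>n]\<close>. Positions \<open>a\<close> are counted from 1,
  so \<open>diff_triangle S b a\<close> is the entry \<open>s\<^sub>a\<^sup>b\<close> in row \<open>b\<close>. It is meaningful
  for \<open>1 \<le> a\<close> and \<open>a + b \<le> length S\<close>; its values elsewhere are never used.
\<close>

primrec diff_triangle :: "int list \<Rightarrow> nat \<Rightarrow> nat \<Rightarrow> int" where
  "diff_triangle S 0 a = S ! (a - 1)"
| "diff_triangle S (Suc b) a = \<bar>diff_triangle S b (a + 1) - diff_triangle S b a\<bar>"

definition gilbreath :: "int list \<Rightarrow> bool" where
  "gilbreath S \<longleftrightarrow> (\<forall>b\<in>{1..length S - 1}. diff_triangle S b 1 = 1)"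

text \<open>Only meant for \<open>n \<ge> 2\<close>.\<close>

definition gilbreath_seqs :: "nat \<Rightarrow> int list set" where
  "gilbreath_seqs n =
     {S. length S = n \<and> sorted_wrt (<) S \<and> gilbreath S \<and> S ! 0 = 2 \<and> S ! 1 = 3}"

definition valid_extensions :: "int list \<Rightarrow> int set" where
  "valid_extensions S = {k. gilbreath (S @ [k])}"

definition antidiag :: "int list \<Rightarrow> nat \<Rightarrow> int" where
  "antidiag S i = diff_triangle S i (length S - i)"

definition antidiag_sum :: "int list \<Rightarrow> int" where
  "antidiag_sum S = (\<Sum>i=1..length S - 1. antidiag S i)"

end

theory Submission
  imports Defs
begin

text \<open>
  Appending \<open>k\<close> to \<open>S\<close> adds one anti-diagonal \<open>f\<^sub>1 = \<bar>k - s\<^sub>n\<bar>\<close>, \<open>f\<^sub>i\<^sub>+\<^sub>1 = \<bar>f\<^sub>i - e\<^sub>i\<bar>\<close>. If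
  \<open>f\<^sub>1 = A(S) + 1\<close>, then \<open>f\<^sub>i = e\<^sub>i + \<dots> + e\<^sub>n\<^sub>-\<^sub>1 + 1\<close> for all \<open>i\<close>: each step only removes the
  leading summand, since the \<open>e\<^sub>i\<close> are nonnegative. Hence \<open>f\<^sub>n = 1\<close>.
\<close>

text \<open>The entry depends only on positions \<open>a\<close> to \<open>a + b\<close> of the
  sequence, all of which lie in \<open>S\<close>.\<close>

lemma diff_triangle_append:
  assumes "1 \<le> a" "a + b \<le> length S"
  shows "diff_triangle (S @ T) b a = diff_triangle S b a"
  using assms by (induction b arbitrary: a) (auto simp: nth_append)

text \<open>From row 1 on, entries are absolute values; row 0 is the sequence itself.\<close>

lemma antidiag_nonneg:
  assumes "1 \<le> i"
  shows "0 \<le> antidiag S i"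
  using assms by (cases i) (simp_all add: antidiag_def)

text \<open>The formula for \<open>f\<^sub>i\<close> with \<open>i = Suc m\<close>; the shift lets
  the induction start at row 1, where \<open>k\<close> applies.\<close>

lemma diff_triangle_snoc_antidiag:
  assumes k: "\<bar>k - last S\<bar> = antidiag_sum S + 1" and "m < length S"
  shows "diff_triangle (S @ [k]) (Suc m) (length S - m)
    = (\<Sum>j = Suc m..length S - 1. antidiag S j) + 1"
  using \<open>m < length S\<close>
proof (induction m)
  case 0
  then show ?case
    using k by (simp add: antidiag_sum_def nth_append last_conv_nth)
next
  case (Suc m)
  have idx: "length S - Suc m + 1 = length S - m"
    using Suc.prems by simp
  have old: "diff_triangle (S @ [k]) (Suc m) (length S - Suc m) = antidiag S (Suc m)"
    unfolding antidiag_def using Suc.prems by (intro diff_triangle_append) auto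
  have split: "(\<Sum>j = Suc m..length S - 1. antidiag S j)
      = antidiag S (Suc m) + (\<Sum>j = Suc (Suc m)..length S - 1. antidiag S j)"
    using Suc.prems by (intro sum.atLeast_Suc_atMost) auto
  \<comment> \<open>Allows the absolute value to be dropped once the leading summand has
    cancelled.\<close>
  have nonneg: "0 \<le> (\<Sum>j = Suc (Suc m)..length S - 1. antidiag S j)"
    by (intro sum_nonneg antidiag_nonneg) auto
  have new: "diff_triangle (S @ [k]) (Suc m) (length S - m)
      = (\<Sum>j = Suc m..length S - 1. antidiag S j) + 1"
    using Suc by simp
  have "diff_triangle (S @ [k]) (Suc (Suc m)) (length S - Suc m)
      = \<bar>diff_triangle (S @ [k]) (Suc m) (length S - m)
         - diff_triangle (S @ [k]) (Suc m) (length S - Suc m)\<bar>"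
    by (subst diff_triangle.simps(2)) (simp only: idx)
  then show ?case
    unfolding new old split using nonneg by linarith
qed

lemma valid_extension_if_dist_last:
  assumes "S \<noteq> []" and S: "gilbreath S" and k: "\<bar>k - last S\<bar> = antidiag_sum S + 1"
  shows "k \<in> valid_extensions S"
proof -
  have "diff_triangle (S @ [k]) b 1 = 1" if "1 \<le> b" "b \<le> length S" for b
  proof (cases "b = length S")
    case True
    moreover have "length S - (length S - 1) = 1"
      using that by simp
    \<comment> \<open>At \<open>m = length S - 1\<close> the sum has an empty range, which leaves
      1.\<close>
    ultimately show ?thesis
      using diff_triangle_snoc_antidiag[OF k, of "length S - 1"] \<open>S \<noteq> []\<close> by simp
  next
    case False
    then have "diff_triangle (S @ [k]) b 1 = diff_triangle S b 1"
      using that by (intro diff_triangle_append) auto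
    then show ?thesis
      using S that False by (simp add: gilbreath_def)
  qed
  then show ?thesis
    by (simp add: valid_extensions_def gilbreath_def)
qed

theorem theorem15:
  fixes n :: nat and S :: "int list"
  assumes "n \<ge> 2" and "S \<in> gilbreath_seqs n"
  shows "last S - antidiag_sum S - 1 \<in> valid_extensions S \<and>
         last S + antidiag_sum S + 1 \<in> valid_extensions S"
proof -
  have S: "S \<noteq> []" "gilbreath S"
    using assms by (auto simp: gilbreath_seqs_def)
  \<comment> \<open>Hence both offsets from \<open>last S\<close>, of either sign, have absolute
    value \<open>antidiag_sum S + 1\<close>.\<close>
  have "0 \<le> antidiag_sum S"
    unfolding antidiag_sum_def by (intro sum_nonneg antidiag_nonneg) auto
  then show ?thesis
    using valid_extension_if_dist_last[OF S] by simp
qed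

end
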